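(* Let $V$ be a countable rank one valuation domain with quotient field $K$ such that the set $\mathcal{W}$ of Ostrowski valuation domains is nonempty. Then $\mathcal{V}=\{V_E\mid E\subset K\text{ is a pseudo-convergent sequence}\}$, endowed with the Zariski topology, is metrizable.
   Context: Let $v$ be the valuation of $V$, with value group regarded as a subgroup of $\mathbb{R}$. A sequence $E=\{s_n\}_{n\in\mathbb{N}}$ in $K$ is pseudo-convergent if $v(s_{n+1}-s_n)<v(s_{n+2}-s_{n+1})$ for all $n$. Let $V_E=\{\phi\in K(X)\mid \phi(s_n)\in V\text{ for all but finitely many }n\in\mathbb{N}\}$, a valuation domain of $K(X)$ lying over $V$. For $\phi\in K(X)$ let $w_E(\phi)=\lim_{n\to\infty}v(\phi(s_n))$; when $w_E$ is a valuation on $K(X)$, $W_E=\{\phi\in K(X)\mid w_E(\phi)\geq 0\}$ is its valuation domain, and $\mathcal{W}$ is the set of all such $W_E$. The Zariski topology on $\mathcal{V}$ is the one generated by the subbasic open sets $\{V_E\in\mathcal{V}\mid \phi\in V_E\}$, for $\phi\in K(X)$. *)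

theory Defs
  imports "HOL-Analysis.Analysis" "HOL-Computational_Algebra.Fraction_Field"
begin

section \<open>Valuation domains\<close>

text \<open>The ambient type plays the role of the field \<open>K\<close>; the last conjunct forces \<open>K\<close> to be the
  quotient field of \<open>V\<close>.\<close>

definition valuation_domain :: "'a::field set \<Rightarrow> bool" where
  "valuation_domain V \<longleftrightarrow>
     1 \<in> V \<and> (\<forall>x\<in>V. \<forall>y\<in>V. x - y \<in> V) \<and> (\<forall>x\<in>V. \<forall>y\<in>V. x * y \<in> V) \<and>
     (\<forall>x. x \<noteq> 0 \<longrightarrow> x \<in> V \<or> inverse x \<in> V)"

definition prime_ideal_of :: "'a::field set \<Rightarrow> 'a set \<Rightarrow> bool" where
  "prime_ideal_of V P \<longleftrightarrow>
     P \<subseteq> V \<and> 0 \<in> P \<and> (\<forall>x\<in>P. \<forall>y\<in>P. x + y \<in> P) \<and> (\<forall>a\<in>V. \<forall>x\<in>P. a * x \<in> P) \<and>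
     P \<noteq> V \<and> (\<forall>a\<in>V. \<forall>b\<in>V. a * b \<in> P \<longrightarrow> a \<in> P \<or> b \<in> P)"

text \<open>The rank of a valuation domain is its Krull dimension: the supremum of the lengths \<open>n\<close> of
  chains of primes \<open>P 0 \<subset> \<dots> \<subset> P n\<close>.\<close>

definition valuation_rank :: "'a::field set \<Rightarrow> enat" where
  "valuation_rank V = Sup {enat n | n. \<exists>P. (\<forall>i\<le>n. prime_ideal_of V (P i)) \<and> (\<forall>i<n. P i \<subset> P (Suc i))}"

text \<open>Valuations with value group inside \<open>\<real>\<close>, written additively, with value \<open>\<infinity>\<close> exactly at \<open>0\<close>.\<close>

definition real_valuation :: "('k::field \<Rightarrow> ereal) \<Rightarrow> bool" where
  "real_valuation v \<longleftrightarrow>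
     v 0 = \<infinity> \<and> (\<forall>x. x \<noteq> 0 \<longrightarrow> \<bar>v x\<bar> \<noteq> \<infinity>) \<and>
     (\<forall>x y. v (x * y) = v x + v y) \<and> (\<forall>x y. min (v x) (v y) \<le> v (x + y))"

definition valuation_ring :: "('k::field \<Rightarrow> ereal) \<Rightarrow> 'k set" where
  "valuation_ring v = {x. 0 \<le> v x}"


section \<open>Evaluation of rational functions\<close>

text \<open>The field \<open>K(X)\<close> is \<open>'a poly fract\<close>. The value at \<open>a\<close> is computed from any representation
  whose denominator does not vanish at \<open>a\<close>; at a pole it is unspecified. This is harmless below,
  where values are only considered at all but finitely many terms of a pseudo-convergent sequence
  (see \<open>eventually_denominator_nonzero\<close>).\<close>

definition rat_eval :: "'a::field poly fract \<Rightarrow> 'a \<Rightarrow> 'a" where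
  "rat_eval \<phi> a =
     (THE y. \<exists>p q. \<phi> = Fract p q \<and> poly q a \<noteq> 0 \<and> y = poly p a / poly q a)"

lemma rat_eval_Fract:
  fixes p q :: "'a::field poly"
  assumes "poly q a \<noteq> 0"
  shows "rat_eval (Fract p q) a = poly p a / poly q a"
  unfolding rat_eval_def
proof (rule the_equality)
  fix y
  assume "\<exists>p' q'. Fract p q = Fract p' q' \<and> poly q' a \<noteq> 0 \<and> y = poly p' a / poly q' a"
  then obtain p' q' where *: "Fract p q = Fract p' q'" "poly q' a \<noteq> 0" "y = poly p' a / poly q' a"
    by blast
  have "q \<noteq> 0" "q' \<noteq> 0" using assms * by auto
  then have "p * q' = p' * q" using * by (simp add: eq_fract)
  then have "poly p a * poly q' a = poly p' a * poly q a" by (metis poly_mult)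
  then show "y = poly p a / poly q a" using * assms by (simp add: frac_eq_eq)
qed (use assms in blast)


section \<open>Valuation domains associated to pseudo-convergent sequences\<close>

definition pseudo_convergent :: "('a::field \<Rightarrow> ereal) \<Rightarrow> (nat \<Rightarrow> 'a) \<Rightarrow> bool" where
  "pseudo_convergent v s \<longleftrightarrow>
     (\<forall>n. v (s (n + 1) - s n) < v (s (n + 2) - s (n + 1)))"

definition V_dom :: "'a::field set \<Rightarrow> (nat \<Rightarrow> 'a) \<Rightarrow> 'a poly fract set" where
  "V_dom V s = {\<phi>. \<forall>\<^sub>F n in sequentially. rat_eval \<phi> (s n) \<in> V}"

definition V_space :: "('a::field \<Rightarrow> ereal) \<Rightarrow> 'a poly fract set set" where
  "V_space v = {V_dom (valuation_ring v) s | s. pseudo_convergent v s}"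

text \<open>The limit is taken in the extended reals; \<open>\<plusminus>\<infinity>\<close> can occur for nonzero \<open>\<phi>\<close>, and then \<open>w_map\<close> is
  not a valuation.\<close>

definition w_map :: "('a::field \<Rightarrow> ereal) \<Rightarrow> (nat \<Rightarrow> 'a) \<Rightarrow> 'a poly fract \<Rightarrow> ereal" where
  "w_map v s \<phi> = lim (\<lambda>n. v (rat_eval \<phi> (s n)))"

definition Ostrowski_domains :: "('a::field \<Rightarrow> ereal) \<Rightarrow> 'a poly fract set set" where
  "Ostrowski_domains v =
     {valuation_ring (w_map v s) | s. pseudo_convergent v s \<and> real_valuation (w_map v s)}"

definition zariski_topology :: "'k set set \<Rightarrow> 'k set topology" where
  "zariski_topology \<X> = topology_generated_by {{A \<in> \<X>. \<phi> \<in> A} | \<phi>. True}"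


lemma real_valuation_uminus:
  assumes "real_valuation v"
  shows "v (- x) = v x"
proof (cases "x = 0")
  case False
  have "v 1 + v 1 = v 1" and fin1: "\<bar>v 1\<bar> \<noteq> \<infinity>"
    using assms unfolding real_valuation_def by (metis mult_1, simp)
  then have v1: "v 1 = 0" by (cases "v 1") auto
  have "v (-1) + v (-1) = v 1" and "\<bar>v (-1)\<bar> \<noteq> \<infinity>"
    using assms unfolding real_valuation_def by (metis mult_minus1 minus_minus, simp)
  then have "v (-1) = 0" using v1 by (cases "v (-1)") (auto simp: zero_ereal_def)
  moreover have "v (- x) = v (-1) + v x"
    using assms unfolding real_valuation_def by (metis mult_minus1)
  ultimately show ?thesis by simp
qed simp

lemma real_valuation_add_eq:
  assumes "real_valuation v" "v x < v y"
  shows "v (x + y) = v x"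
proof (rule antisym)
  have "min (v (x + y)) (v (- y)) \<le> v ((x + y) + (- y))"
    using assms(1) unfolding real_valuation_def by blast
  then show "v (x + y) \<le> v x"
    using assms real_valuation_uminus[OF assms(1), of y] by (auto simp: min_def split: if_splits)
  have "min (v x) (v y) \<le> v (x + y)"
    using assms(1) unfolding real_valuation_def by blast
  then show "v x \<le> v (x + y)" using assms(2) by simp
qed

lemma pseudo_convergent_inj:
  assumes v: "real_valuation v" and s: "pseudo_convergent v s"
  shows "inj s"
proof -
  define g where "g n = v (s (Suc n) - s n)" for n
  have g: "g n < g (Suc n)" for n
    using s unfolding pseudo_convergent_def g_def by simp
  have d: "v (s (m + Suc k) - s m) = g m" for m k
  proof (induction k arbitrary: m)
    case (Suc k)
    have "s (m + Suc (Suc k)) - s m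
            = (s (Suc m) - s m) + (s (Suc m + Suc k) - s (Suc m))" by simp
    then show ?case
      using real_valuation_add_eq[OF v, of "s (Suc m) - s m" "s (Suc m + Suc k) - s (Suc m)"]
        Suc[of "Suc m"] g[of m] unfolding g_def by simp
  qed (simp add: g_def)
  have "s m \<noteq> s n" if "m < n" for m n
  proof
    assume "s m = s n"
    obtain k where "n = m + Suc k" using less_imp_Suc_add[OF \<open>m < n\<close>] by auto
    then have "g m = \<infinity>" using d[of m k] \<open>s m = s n\<close> v unfolding real_valuation_def by simp
    then show False using g[of m] by simp
  qed
  then show ?thesis by (metis injI linorder_neqE_nat)
qed

lemma eventually_denominator_nonzero:
  assumes "real_valuation v" "pseudo_convergent v s" "q \<noteq> 0"
  shows "\<forall>\<^sub>F n in sequentially. poly q (s n) \<noteq> 0"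
proof -
  have "finite (s -` {x. poly q x = 0})"
    using poly_roots_finite[OF assms(3)] pseudo_convergent_inj[OF assms(1,2)]
    by (intro finite_vimageI) auto
  then show ?thesis
    unfolding cofinite_eq_sequentially[symmetric] eventually_cofinite by (simp add: vimage_def)
qed

end

theory Submission
  imports Defs
begin

text \<open>For a nonzero polynomial \<open>f\<close> and a nonzero constant \<open>c\<close>, the Zariski open set of the \<open>V\<^sub>E\<close>
  containing \<open>c/f\<close> is also closed, because the values of \<open>f\<close> along a pseudo-convergent sequence are
  ultimately nondecreasing. Finite intersections of these sets and their complements form a base: let
  \<open>\<mu>\<close> be a polynomial of minimal degree whose values along \<open>E\<close> are not ultimately constant. By the
  \<open>\<mu>\<close>-adic expansion, near \<open>E\<close> the value of a polynomial is governed by a tropical polynomial in the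
  value of \<open>\<mu>\<close>. So \<open>v q \<le> v p\<close> holds on a ball around \<open>E\<close> as long as \<open>v \<mu>\<close> stays below its limit along
  \<open>E\<close>, and one condition \<open>v f \<le> v c\<close> with \<open>f\<close> a power of \<open>q\<close> or \<open>\<mu>\<close> handles the values beyond the limit.
  As \<open>K\<close> is countable, this is a countable base of clopen sets, and the space embeds into a countable
  product of two-point discrete spaces.\<close>

section \<open>Affine functions and polynomial expansions\<close>

text \<open>The difference of two lines with distinct slopes is strictly monotone along
  \<open>g\<close>, so its sign is ultimately constant and nonzero. By induction on \<open>S\<close>
  it is enough to compare each new index with the minimum found so far.\<close>

lemma eventually_unique_minimal:
  fixes \<alpha> g :: "nat \<Rightarrow> real"
  assumes "strict_mono g" "finite S" "S \<noteq> {}"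
  shows "\<exists>i\<in>S. \<exists>N. \<forall>n\<ge>N. \<forall>j\<in>S-{i}. \<alpha> i + real i * g n < \<alpha> j + real j * g n"
  using assms(2,3)
proof (induction S rule: finite_ne_induct)
  case (singleton x)
  then show ?case by simp
next
  case (insert x F)
  then obtain i N where i: "i \<in> F"
    and N: "\<And>n j. n \<ge> N \<Longrightarrow> j \<in> F - {i} \<Longrightarrow> \<alpha> i + real i * g n < \<alpha> j + real j * g n"
    by blast
  have ix: "i \<noteq> x" using insert i by auto
  define D where "D n = (\<alpha> i - \<alpha> x) + (real i - real x) * g n" for n
  have mono: "g m < g n" if "m < n" for m n
    using assms(1) that by (simp add: strict_mono_def)
  \<comment> \<open>If \<open>D\<close> meets 0 at \<open>m\<close>, strict monotonicity has carried
    it past 0 from \<open>Suc m\<close> on.\<close>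
  have "(\<exists>M. \<forall>n\<ge>M. D n < 0) \<or> (\<exists>M. \<forall>n\<ge>M. D n > 0)"
  proof (cases "i < x")
    case True
    then have *: "D n < D m" if "m < n" for m n
      using mono[OF that] by (auto simp: D_def intro!: mult_strict_left_mono_neg)
    show ?thesis
    proof (cases "\<exists>m. D m \<le> 0")
      case True
      then obtain m where "D m \<le> 0" by blast
      then have "\<forall>n\<ge>Suc m. D n < 0" using * by (metis Suc_le_eq order_less_le_trans)
      then show ?thesis by blast
    qed (auto simp: not_le)
  next
    case False
    then have "x < i" using ix by simp
    then have *: "D m < D n" if "m < n" for m n
      using mono[OF that] by (auto simp: D_def intro!: mult_strict_left_mono)
    show ?thesis
    proof (cases "\<exists>m. D m \<ge> 0")
      case True
      then obtain m where "D m \<ge> 0" by blast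
      then have "\<forall>n\<ge>Suc m. D n > 0" using * by (metis Suc_le_eq order_le_less_trans)
      then show ?thesis by blast
    qed (auto simp: not_le)
  qed
  then show ?case
  proof
    assume "\<exists>M. \<forall>n\<ge>M. D n < 0"
    then obtain M where M: "\<And>n. n \<ge> M \<Longrightarrow> D n < 0" by blast
    have "\<alpha> i + real i * g n < \<alpha> j + real j * g n"
      if "n \<ge> max M N" "j \<in> insert x F - {i}" for n j
      using M[of n] N[of n j] that by (cases "j = x") (auto simp: D_def algebra_simps)
    then show ?thesis using i by blast
  next
    assume "\<exists>M. \<forall>n\<ge>M. D n > 0"
    then obtain M where M: "\<And>n. n \<ge> M \<Longrightarrow> D n > 0" by blast
    have "\<alpha> x + real x * g n < \<alpha> j + real j * g n"
      if "n \<ge> max M N" "j \<in> insert x F - {x}" for n j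
    proof -
      have a: "\<alpha> x + real x * g n < \<alpha> i + real i * g n"
        using M[of n] that by (auto simp: D_def algebra_simps)
      then show ?thesis using N[of n j] that by (cases "j = i") fastforce+
    qed
    then show ?thesis by blast
  qed
qed

text \<open>The inequality propagates upwards from \<open>x\<close> if \<open>b \<le> d\<close>, and
  downwards from \<open>z\<close> otherwise.\<close>

lemma affine_le_between:
  fixes a b c d x y z :: real
  assumes "a + b * x \<le> c + d * x" "a + b * z \<le> c + d * z" "x \<le> y" "y \<le> z"
  shows "a + b * y \<le> c + d * y"
proof (cases "b \<le> d")
  case True
  then have "(d - b) * x \<le> (d - b) * y" using assms by (intro mult_left_mono) auto
  then show ?thesis using assms(1) by (simp add: algebra_simps)
next
  case False
  then have "(b - d) * y \<le> (b - d) * z" using assms by (intro mult_left_mono) auto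
  then show ?thesis using assms(2) by (simp add: algebra_simps)
qed

lemma affine_less_between:
  fixes a b c d x y z :: real
  assumes "a + b * x < c + d * x" "a + b * z < c + d * z" "x \<le> y" "y \<le> z"
  shows "a + b * y < c + d * y"
proof (cases "b \<le> d")
  case True
  then have "(d - b) * x \<le> (d - b) * y" using assms by (intro mult_left_mono) auto
  then show ?thesis using assms(1) by (simp add: algebra_simps)
next
  case False
  then have "(b - d) * y \<le> (b - d) * z" using assms by (intro mult_left_mono) auto
  then show ?thesis using assms(2) by (simp add: algebra_simps)
qed

text \<open>The \<open>H k\<close> are the Hasse derivatives of \<open>p\<close>; they involve no
  division by factorials, so the expansion holds in every characteristic.\<close>

lemma poly_taylor_exists:
  fixes p :: "'a::field poly"
  shows "\<exists>H M. (\<forall>k. H k = 0 \<or> degree (H k) + k \<le> degree p) \<and>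
    (\<forall>a x. poly p x - poly p a = (\<Sum>k=1..M. poly (H k) a * (x - a) ^ k))"
proof -
  have "\<exists>H. H 0 = p \<and> (\<forall>k. H k = 0 \<or> degree (H k) + k \<le> degree p) \<and>
    (\<forall>a x. poly p x = (\<Sum>k\<le>degree p. poly (H k) a * (x - a) ^ k))"
  proof (induction p)
    case 0
    show ?case by (intro exI[of _ "\<lambda>_. 0"]) auto
  next
    case (pCons c p)
    show ?case
    proof (cases "p = 0")
      case True
      then show ?thesis
        by (intro exI[of _ "\<lambda>k. if k = 0 then [:c:] else 0"]) auto
    next
      case False
      from pCons obtain H where H0: "H 0 = p" and deg: "\<And>k. H k = 0 \<or> degree (H k) + k \<le> degree p"
        and H: "\<And>a x. poly p x = (\<Sum>k\<le>degree p. poly (H k) a * (x - a) ^ k)" by blast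
      \<comment> \<open>Writing \<open>X = a + (X - a)\<close>, the Hasse derivative of
        \<open>c + X * p\<close> of order \<open>Suc j\<close> is \<open>X\<close> times that of
        \<open>p\<close> plus the one of \<open>p\<close> of order \<open>j\<close>.\<close>
      define G where "G k = (case k of 0 \<Rightarrow> pCons c p | Suc j \<Rightarrow> pCons 0 (H k) + H j)" for k
      have dG: "G k = 0 \<or> degree (G k) + k \<le> degree (pCons c p)" for k
      proof (cases k)
        case 0
        then show ?thesis by (simp add: G_def)
      next
        case (Suc j)
        have d1: "degree (pCons 0 (H k)) \<le> degree p - j"
        proof (cases "H k = 0")
          case False
          then show ?thesis using deg[of k] Suc by (simp)
        qed simp
        have d2: "degree (H j) \<le> degree p - j" using deg[of j] by auto
        have "degree (G k) \<le> degree p - j"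
          using d1 d2 by (simp add: G_def Suc degree_add_le)
        moreover have "G k = 0" if "j > degree p"
          using deg[of j] deg[of k] that Suc by (auto simp: G_def)
        ultimately show ?thesis using False Suc by (cases "j \<le> degree p") auto
      qed
      have "poly (pCons c p) x = (\<Sum>k\<le>degree (pCons c p). poly (G k) a * (x - a) ^ k)" for a x
      proof -
        define d where "d = degree p"
        have Hd: "H (Suc d) = 0" using deg[of "Suc d"] by (auto simp: d_def)
        have "(\<Sum>k\<le>Suc d. poly (G k) a * (x - a) ^ k)
          = poly (G 0) a + (\<Sum>k\<le>d. poly (G (Suc k)) a * (x - a) ^ Suc k)"
          by (subst sum.atMost_Suc_shift) simp
        also have "(\<Sum>k\<le>d. poly (G (Suc k)) a * (x - a) ^ Suc k)
          = a * (\<Sum>k\<le>d. poly (H (Suc k)) a * (x - a) ^ Suc k)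
            + (x - a) * (\<Sum>k\<le>d. poly (H k) a * (x - a) ^ k)"
          by (simp add: G_def sum_distrib_left sum.distrib[symmetric] algebra_simps)
        also have "(\<Sum>k\<le>d. poly (H (Suc k)) a * (x - a) ^ Suc k)
           = (\<Sum>k\<le>Suc d. poly (H k) a * (x - a) ^ k) - poly (H 0) a"
          by (subst sum.atMost_Suc_shift) simp
        also have "(\<Sum>k\<le>Suc d. poly (H k) a * (x - a) ^ k) = poly p x"
          using Hd by (simp add: H[of x a] d_def)
        also have "(\<Sum>k\<le>d. poly (H k) a * (x - a) ^ k) = poly p x"
          by (simp add: H[of x a] d_def)
        finally have "(\<Sum>k\<le>Suc d. poly (G k) a * (x - a) ^ k) = poly (pCons c p) x"
          by (simp add: G_def H0 algebra_simps)
        then show ?thesis using False by (simp add: d_def)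
      qed
      then show ?thesis using dG by (intro exI[of _ G]) (auto simp: G_def)
    qed
  qed
  then obtain H where H0: "H 0 = p" and deg: "\<forall>k. H k = 0 \<or> degree (H k) + k \<le> degree p"
    and H: "\<And>a x. poly p x = (\<Sum>k\<le>degree p. poly (H k) a * (x - a) ^ k)" by blast
  have "poly p x - poly p a = (\<Sum>k=1..degree p. poly (H k) a * (x - a) ^ k)" for a x
    by (subst H[of x a]) (simp add: H0 atMost_atLeast0 sum.atLeast_Suc_atMost)
  then show ?thesis using deg by blast
qed

text \<open>Repeated division with remainder by \<open>\<mu>\<close>; the remainders are the
  digits.\<close>

lemma poly_adic_expansion_exists:
  fixes \<mu> p :: "'a::field poly"
  assumes "degree \<mu> > 0"
  shows "\<exists>a M. (\<forall>i. a i = 0 \<or> degree (a i) < degree \<mu>) \<and> p = (\<Sum>i\<le>M. a i * \<mu> ^ i)"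
proof (induction "degree p" arbitrary: p rule: less_induct)
  case less
  show ?case
  proof (cases "degree p < degree \<mu>")
    case True
    then show ?thesis
      by (intro exI[of _ "\<lambda>i. if i = 0 then p else 0"] exI[of _ 0]) auto
  next
    case False
    have "degree (p div \<mu>) < degree p"
      using assms False by (simp add: degree_div_less)
    from less[OF this] obtain a M where a: "\<And>i. a i = 0 \<or> degree (a i) < degree \<mu>"
      and p: "p div \<mu> = (\<Sum>i\<le>M. a i * \<mu> ^ i)" by blast
    define b where "b i = (case i of 0 \<Rightarrow> p mod \<mu> | Suc j \<Rightarrow> a j)" for i
    have "p = p mod \<mu> + (p div \<mu>) * \<mu>" by simp
    also have "\<dots> = (\<Sum>i\<le>Suc M. b i * \<mu> ^ i)"
      by (subst sum.atMost_Suc_shift) (simp add: b_def p sum_distrib_left sum_distrib_right algebra_simps)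
    finally have "p = (\<Sum>i\<le>Suc M. b i * \<mu> ^ i)" .
    moreover have "b i = 0 \<or> degree (b i) < degree \<mu>" for i
      using a assms degree_mod_less[of \<mu> p] by (cases i; cases "\<mu> = 0") (auto simp: b_def)
    ultimately show ?thesis by blast
  qed
qed

section \<open>Fields with a real valuation\<close>

locale real_valued_field =
  fixes v :: "'a::field \<Rightarrow> ereal"
  assumes rv: "real_valuation v"
begin

lemma v_0 [simp]: "v 0 = \<infinity>"
  and v_mult: "v (x * y) = v x + v y"
  and v_add_ge: "min (v x) (v y) \<le> v (x + y)"
  using rv by (auto simp: real_valuation_def)

lemma v_finite: "x \<noteq> 0 \<Longrightarrow> \<exists>r. v x = ereal r"
  using rv by (auto simp: real_valuation_def)

lemma v_less_nonzero: "v x < y \<Longrightarrow> x \<noteq> 0"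
  by auto

lemma v_1 [simp]: "v 1 = 0"
proof -
  obtain r where "v 1 = ereal r" using v_finite[of 1] by auto
  then show ?thesis using v_mult[of 1 1] by (simp add: zero_ereal_def)
qed

lemma v_uminus: "v (- x) = v x"
  by (rule real_valuation_uminus[OF rv])

lemma v_add_eq: "v x < v y \<Longrightarrow> v (x + y) = v x"
  by (rule real_valuation_add_eq[OF rv])

lemma v_power: "v x = ereal y \<Longrightarrow> v (x ^ k) = ereal (real k * y)"
  by (induction k) (auto simp: v_mult zero_ereal_def algebra_simps)

lemma v_divide:
  assumes "y \<noteq> 0"
  shows "0 \<le> v (x / y) \<longleftrightarrow> v y \<le> v x"
proof -
  have "v x = v (x / y) + v y" using assms by (simp add: v_mult[symmetric])
  moreover obtain r where "v y = ereal r" using v_finite[OF assms] by auto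
  ultimately show ?thesis by (cases "v (x / y)") (auto simp: zero_ereal_def)
qed

lemma v_sum_ge:
  assumes "finite A" "\<And>i. i \<in> A \<Longrightarrow> m \<le> v (f i)"
  shows "m \<le> v (\<Sum>i\<in>A. f i)"
  using assms
proof (induction rule: finite_induct)
  case (insert i A)
  then show ?case using insert order_trans[OF _ v_add_ge]
    by (metis insertCI min.boundedI sum.insert)
qed simp

lemma v_sum_gt:
  assumes "finite A" "m < \<infinity>" "\<And>i. i \<in> A \<Longrightarrow> m < v (f i)"
  shows "m < v (\<Sum>i\<in>A. f i)"
  using assms
proof (induction rule: finite_induct)
  case (insert i A)
  then show ?case using insert less_le_trans[OF _ v_add_ge]
    by (metis insertCI min_less_iff_conj sum.insert)
qed simp

lemma v_sum_unique_minimal: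
  assumes "finite A" "j \<in> A" "v (f j) < \<infinity>" "\<And>i. i \<in> A - {j} \<Longrightarrow> v (f j) < v (f i)"
  shows "v (\<Sum>i\<in>A. f i) = v (f j)"
proof -
  have "v (f j) < v (\<Sum>i\<in>A-{j}. f i)"
    using assms by (intro v_sum_gt) auto
  from v_add_eq[OF this] show ?thesis using assms by (simp add: sum.remove)
qed

end

section \<open>Polynomials along a pseudo-convergent sequence\<close>

locale pseudo_convergent_sequence = real_valued_field v for v :: "'a::field \<Rightarrow> ereal" +
  fixes t :: "nat \<Rightarrow> 'a"
  assumes pc: "pseudo_convergent v t"
begin

section \<open>Gaps and nested balls of the sequence\<close>

definition gap :: "nat \<Rightarrow> real" where
  "gap n = real_of_ereal (v (t (Suc n) - t n))"

text \<open>Each gap lies strictly below the next one, hence is finite.\<close>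

lemma v_step: "v (t (Suc n) - t n) = ereal (gap n)"
proof -
  have "v (t (Suc n) - t n) < v (t (Suc (Suc n)) - t (Suc n))"
    using pc by (simp add: pseudo_convergent_def)
  then show ?thesis using v_finite[OF v_less_nonzero] by (fastforce simp: gap_def)
qed

lemma gap_less_iff [simp]: "gap m < gap n \<longleftrightarrow> m < n"
proof -
  have "gap n < gap (Suc n)" for n
    using pc v_step[of n] v_step[of "Suc n"]
    by (metis Suc_eq_plus1 add_2_eq_Suc' ereal_less_eq(5) less_ereal.simps(1) pseudo_convergent_def)
  then have "strict_mono gap" by (rule strict_monoI_Suc)
  then show ?thesis by (rule strict_mono_less)
qed

text \<open>The open ball around \<open>t (Suc n)\<close> that just excludes \<open>t n\<close>. It
  contains all later terms, and on it \<open>x - t n\<close> has value exactly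
  \<open>gap n\<close>.\<close>

definition tail_ball :: "nat \<Rightarrow> 'a set" where
  "tail_ball n = {x. ereal (gap n) < v (x - t (Suc n))}"

lemma v_tail_ball:
  assumes "x \<in> tail_ball n"
  shows "v (x - t n) = ereal (gap n)"
  using v_add_eq[of "t (Suc n) - t n" "x - t (Suc n)"] assms
  by (simp add: tail_ball_def v_step)

lemma tail_ball_Suc: "x \<in> tail_ball (Suc n) \<Longrightarrow> x \<in> tail_ball n"
  using v_tail_ball[of x "Suc n"] by (simp add: tail_ball_def)

lemma tail_ball_antimono:
  assumes "m \<le> n" "x \<in> tail_ball n"
  shows "x \<in> tail_ball m"
  using assms(1,2) by (induction rule: dec_induct) (auto dest: tail_ball_Suc)

lemma sequence_in_tail_ball: "n < m \<Longrightarrow> t m \<in> tail_ball n"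
proof -
  assume "n < m"
  then obtain k where m: "m = Suc k" "n \<le> k" by (cases m) auto
  have "t (Suc k) \<in> tail_ball k" by (simp add: tail_ball_def)
  then show ?thesis using m tail_ball_antimono by blast
qed

text \<open>The constant is a real number, so the zero polynomial does not qualify.\<close>

definition ultimately_constant :: "'a poly \<Rightarrow> bool" where
  "ultimately_constant f \<longleftrightarrow> (\<exists>\<gamma>. \<forall>\<^sub>F n in sequentially. v (poly f (t n)) = ereal \<gamma>)"

lemma eventually_poly_nonzero:
  "f \<noteq> 0 \<Longrightarrow> \<forall>\<^sub>F n in sequentially. poly f (t n) \<noteq> 0"
  by (rule eventually_denominator_nonzero[OF rv pc])

lemma ultimately_constant_const: "c \<noteq> 0 \<Longrightarrow> ultimately_constant [:c:]"
  using v_finite[of c] by (auto simp: ultimately_constant_def)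

text \<open>The Hasse derivatives of \<open>p\<close> have lower degree, so the Taylor terms at \<open>t n\<close> have values
  affine in \<open>gap n\<close> with distinct slopes, and ultimately one of them dominates.\<close>

lemma v_poly_diff:
  assumes lower: "\<And>f. f \<noteq> 0 \<Longrightarrow> degree f < degree p \<Longrightarrow> ultimately_constant f"
  shows "(\<forall>x a. poly p x = poly p a) \<or>
    (\<exists>N \<beta> r. r > 0 \<and> (\<forall>n\<ge>N. \<forall>x\<in>tail_ball n.
       v (poly p x - poly p (t n)) = ereal (\<beta> + real r * gap n)))"
proof -
  obtain H M where deg: "\<And>k. H k = 0 \<or> degree (H k) + k \<le> degree p"
    and H: "\<And>a x. poly p x - poly p a = (\<Sum>k=1..M. poly (H k) a * (x - a) ^ k)"
    using poly_taylor_exists[of p] by blast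
  define S where "S = {k\<in>{1..M}. H k \<noteq> 0}"
  have HS: "poly p x - poly p a = (\<Sum>k\<in>S. poly (H k) a * (x - a) ^ k)" for a x
    unfolding H by (rule sum.mono_neutral_right) (auto simp: S_def)
  have "finite S" by (simp add: S_def)
  show ?thesis
  proof (cases "S = {}")
    case True
    then show ?thesis using HS by simp
  next
    case False
    have "ultimately_constant (H k)" if "k \<in> S" for k
      using that deg[of k] by (intro lower) (auto simp: S_def)
    then obtain \<beta> where \<beta>: "\<And>k. k \<in> S \<Longrightarrow> \<forall>\<^sub>F n in sequentially. v (poly (H k) (t n)) = ereal (\<beta> k)"
      unfolding ultimately_constant_def by metis
    then have "\<forall>\<^sub>F n in sequentially. \<forall>k\<in>S. v (poly (H k) (t n)) = ereal (\<beta> k)"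
      using \<open>finite S\<close> by (simp add: eventually_ball_finite)
    then obtain N1 where N1: "\<And>n k. n \<ge> N1 \<Longrightarrow> k \<in> S \<Longrightarrow> v (poly (H k) (t n)) = ereal (\<beta> k)"
      unfolding eventually_sequentially by blast
    have "strict_mono gap" by (simp add: strict_mono_def)
    from eventually_unique_minimal[OF this \<open>finite S\<close> False, of \<beta>]
    obtain r N2 where r: "r \<in> S"
      and N2: "\<And>n j. n \<ge> N2 \<Longrightarrow> j \<in> S - {r} \<Longrightarrow> \<beta> r + real r * gap n < \<beta> j + real j * gap n"
      by blast
    have "v (poly p x - poly p (t n)) = ereal (\<beta> r + real r * gap n)"
      if n: "n \<ge> max N1 N2" and x: "x \<in> tail_ball n" for n x
    proof -
      have summand: "v (poly (H k) (t n) * (x - t n) ^ k) = ereal (\<beta> k + real k * gap n)"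
        if "k \<in> S" for k
        using N1[of n k] n that v_power[OF v_tail_ball[OF x], of k] by (simp add: v_mult)
      show ?thesis
        unfolding HS
        by (subst v_sum_unique_minimal[OF \<open>finite S\<close> r])
          (use n N2[of n] r in \<open>auto simp: summand\<close>)
    qed
    moreover have "r > 0" using r by (auto simp: S_def)
    ultimately show ?thesis by blast
  qed
qed

text \<open>Two consecutive terms with value \<gamma> force the value of the difference to be at
  least \<gamma>. By \<open>v_poly_diff\<close> that value strictly increases with the index, so one
  index later it exceeds \<gamma>, and adding such a difference leaves the value \<gamma>
  unchanged.\<close>

lemma v_constant_on_tail_ball:
  assumes lower: "\<And>f. f \<noteq> 0 \<Longrightarrow> degree f < degree p \<Longrightarrow> ultimately_constant f"
    and "ultimately_constant p"
  shows "\<exists>N \<gamma>. \<forall>x\<in>tail_ball N. v (poly p x) = ereal \<gamma>"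
proof -
  obtain \<gamma> N1 where N1: "\<And>n. n \<ge> N1 \<Longrightarrow> v (poly p (t n)) = ereal \<gamma>"
    using assms(2) by (auto simp: ultimately_constant_def eventually_sequentially)
  from v_poly_diff[of p, OF lower] consider "\<forall>x a. poly p x = poly p a"
    | N \<beta> r where "r > 0"
      "\<And>n x. n \<ge> N \<Longrightarrow> x \<in> tail_ball n \<Longrightarrow> v (poly p x - poly p (t n)) = ereal (\<beta> + real r * gap n)"
    by blast
  then show ?thesis
  proof cases
    case 1
    then have "v (poly p x) = ereal \<gamma>" for x using N1[of N1] by (metis order_refl)
    then show ?thesis by blast
  next
    case (2 N \<beta> r)
    define m where "m = max N N1"
    have "min (v (poly p (t (Suc m)))) (v (- poly p (t m))) \<le> v (poly p (t (Suc m)) + (- poly p (t m)))"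
      by (rule v_add_ge)
    then have "\<gamma> \<le> \<beta> + real r * gap m"
      using 2(2)[of m "t (Suc m)"] N1[of m] N1[of "Suc m"] sequence_in_tail_ball[of m "Suc m"]
      by (simp add: v_uminus m_def)
    also have "\<dots> < \<beta> + real r * gap (Suc m)" using 2(1) by simp
    finally have less: "\<gamma> < \<beta> + real r * gap (Suc m)" .
    have "v (poly p x) = ereal \<gamma>" if "x \<in> tail_ball (Suc m)" for x
      using v_add_eq[of "poly p (t (Suc m))" "poly p x - poly p (t (Suc m))"]
        2(2)[OF _ that] N1[of "Suc m"] less by (simp add: m_def)
    then show ?thesis by blast
  qed
qed

section \<open>The minimal nonconstant polynomial and tropical expansions\<close>

definition minimal_nonconstant :: "'a poly \<Rightarrow> bool" where
  "minimal_nonconstant \<mu> \<longleftrightarrow> \<mu> \<noteq> 0 \<and> \<not> ultimately_constant \<mu> \<and>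
     (\<forall>f. f \<noteq> 0 \<and> degree f < degree \<mu> \<longrightarrow> ultimately_constant f)"

lemma minimal_nonconstant_exists:
  assumes "f \<noteq> 0" "\<not> ultimately_constant f"
  shows "\<exists>\<mu>. minimal_nonconstant \<mu>"
proof -
  from assms obtain \<mu> where "\<mu> \<noteq> 0 \<and> \<not> ultimately_constant \<mu>"
    "\<And>f. f \<noteq> 0 \<and> \<not> ultimately_constant f \<Longrightarrow> degree \<mu> \<le> degree f"
    using ex_has_least_nat[of "\<lambda>f. f \<noteq> 0 \<and> \<not> ultimately_constant f" f degree]
    by blast
  then show ?thesis unfolding minimal_nonconstant_def by (meson leD)
qed

lemma minimal_nonconstant_degree: "minimal_nonconstant \<mu> \<Longrightarrow> degree \<mu> > 0"
  using ultimately_constant_const by (auto simp: minimal_nonconstant_def elim!: degree_eq_zeroE intro!: gr0I)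

text \<open>Let \<open>g n\<close> be the value of \<open>poly \<mu> x - poly \<mu> (t n)\<close> on
  \<open>tail_ball n\<close>. If \<open>v (poly \<mu> (t n))\<close> were below \<open>g n\<close>,
  it would be the value at all later terms, making \<open>\<mu>\<close> ultimately constant. If it
  were above, the value at \<open>t (Suc n)\<close> would be \<open>g n\<close>, which is below
  \<open>g (Suc n)\<close>, the case just excluded.\<close>

lemma minimal_nonconstant_growth:
  assumes "minimal_nonconstant \<mu>"
  shows "\<exists>g N. strict_mono g \<and> (\<forall>n\<ge>N. v (poly \<mu> (t n)) = ereal (g n)) \<and>
    (\<forall>n\<ge>N. \<forall>x\<in>tail_ball n. ereal (g n) \<le> v (poly \<mu> x))"
proof -
  have lower: "\<And>f. f \<noteq> 0 \<Longrightarrow> degree f < degree \<mu> \<Longrightarrow> ultimately_constant f"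
    and nonconst: "\<mu> \<noteq> 0" "\<not> ultimately_constant \<mu>"
    using assms by (auto simp: minimal_nonconstant_def)
  from v_poly_diff[of \<mu>, OF lower] consider "\<forall>x a. poly \<mu> x = poly \<mu> a"
    | N \<beta> r where "r > 0"
      "\<And>n x. n \<ge> N \<Longrightarrow> x \<in> tail_ball n \<Longrightarrow> v (poly \<mu> x - poly \<mu> (t n)) = ereal (\<beta> + real r * gap n)"
    by blast
  then show ?thesis
  proof cases
    case 1
    obtain n where "poly \<mu> (t n) \<noteq> 0"
      using eventually_happens'[OF _ eventually_poly_nonzero[OF nonconst(1)]] by auto
    then obtain \<gamma> where "v (poly \<mu> (t n)) = ereal \<gamma>" using v_finite by blast
    then have "v (poly \<mu> (t m)) = ereal \<gamma>" for m using 1 by metis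
    then have "ultimately_constant \<mu>" by (auto simp: ultimately_constant_def)
    with nonconst show ?thesis by simp
  next
    case (2 N \<beta> r)
    define g where "g n = \<beta> + real r * gap n" for n
    have g: "strict_mono g" using 2(1) by (simp add: g_def strict_mono_def)
    have diff: "v (poly \<mu> x - poly \<mu> (t n)) = ereal (g n)" if "n \<ge> N" "x \<in> tail_ball n" for n x
      using 2(2)[OF that] by (simp add: g_def)
    have ge: "ereal (g n) \<le> v (poly \<mu> (t n))" if "n \<ge> N" for n
    proof (rule ccontr)
      assume "\<not> ?thesis"
      then have less: "v (poly \<mu> (t n)) < ereal (g n)" by simp
      have "v (poly \<mu> (t m)) = v (poly \<mu> (t n))" if "m > n" for m
        using v_add_eq[of "poly \<mu> (t n)" "poly \<mu> (t m) - poly \<mu> (t n)"] less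
          diff[OF \<open>n \<ge> N\<close> sequence_in_tail_ball[OF that]] by simp
      moreover obtain \<gamma> where "v (poly \<mu> (t n)) = ereal \<gamma>"
        using v_finite[OF v_less_nonzero[OF less]] by blast
      ultimately have "ultimately_constant \<mu>"
        unfolding ultimately_constant_def eventually_sequentially by (metis Suc_le_lessD)
      with nonconst show False by simp
    qed
    have eq: "v (poly \<mu> (t n)) = ereal (g n)" if "n \<ge> N" for n
    proof (rule ccontr)
      assume "v (poly \<mu> (t n)) \<noteq> ereal (g n)"
      then have "ereal (g n) < v (poly \<mu> (t n))" using ge[OF that] by simp
      then have "v (poly \<mu> (t (Suc n))) = ereal (g n)"
        using v_add_eq[of "poly \<mu> (t (Suc n)) - poly \<mu> (t n)" "poly \<mu> (t n)"]
          diff[OF that, of "t (Suc n)"] sequence_in_tail_ball[of n "Suc n"] by simp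
      then show False using ge[of "Suc n"] that strict_monoD[OF g, of n "Suc n"] by simp
    qed
    have "ereal (g n) \<le> v (poly \<mu> x)" if "n \<ge> N" "x \<in> tail_ball n" for n x
      using v_add_ge[of "poly \<mu> x - poly \<mu> (t n)" "poly \<mu> (t n)"] diff[OF that] eq[OF that(1)]
      by simp
    then show ?thesis using g eq by blast
  qed
qed

text \<open>On a small ball around \<open>t\<close>, a polynomial behaves like the tropical polynomial with
  coefficients \<open>\<alpha>\<close> in the value of \<open>\<mu>\<close>.\<close>

definition tropical_expansion ::
  "'a poly \<Rightarrow> 'a poly \<Rightarrow> nat set \<Rightarrow> (nat \<Rightarrow> real) \<Rightarrow> nat \<Rightarrow> bool" where
  "tropical_expansion \<mu> p S \<alpha> N \<longleftrightarrow> finite S \<and> S \<noteq> {} \<and> (\<forall>i\<in>S. ereal (\<alpha> i) \<in> range v) \<and>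
     (\<forall>x\<in>tail_ball N. \<forall>y. v (poly \<mu> x) = ereal y \<longrightarrow>
        (\<forall>m. (\<forall>i\<in>S. m \<le> \<alpha> i + real i * y) \<longrightarrow> ereal m \<le> v (poly p x)) \<and>
        (\<forall>i\<in>S. (\<forall>j\<in>S-{i}. \<alpha> i + real i * y < \<alpha> j + real j * y) \<longrightarrow>
           v (poly p x) = ereal (\<alpha> i + real i * y)))"

text \<open>The coefficients of the \<open>\<mu>\<close>-adic expansion have degree below that of
  \<open>\<mu>\<close>, so by minimality their values are constant near the sequence. There the
  summand of index \<open>i\<close> has value \<open>\<alpha> i + real i * y\<close>.\<close>

lemma tropical_expansion_exists:
  assumes \<mu>: "minimal_nonconstant \<mu>" and "p \<noteq> 0"
  shows "\<exists>S \<alpha> N. tropical_expansion \<mu> p S \<alpha> N"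
proof -
  obtain a M where deg: "\<And>i. a i = 0 \<or> degree (a i) < degree \<mu>"
    and p: "p = (\<Sum>i\<le>M. a i * \<mu> ^ i)"
    using poly_adic_expansion_exists[OF minimal_nonconstant_degree[OF \<mu>], of p] by blast
  define S where "S = {i\<in>{..M}. a i \<noteq> 0}"
  have pS: "p = (\<Sum>i\<in>S. a i * \<mu> ^ i)"
    unfolding p by (rule sum.mono_neutral_right) (auto simp: S_def)
  have fin: "finite S" by (simp add: S_def)
  have ne: "S \<noteq> {}" using pS \<open>p \<noteq> 0\<close> by auto
  have "\<exists>N \<gamma>. \<forall>x\<in>tail_ball N. v (poly (a i) x) = ereal \<gamma>" if "i \<in> S" for i
  proof (rule v_constant_on_tail_ball)
    have "a i \<noteq> 0" "degree (a i) < degree \<mu>" using deg[of i] that by (auto simp: S_def)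
    then show "ultimately_constant (a i)"
      and "\<And>f. f \<noteq> 0 \<Longrightarrow> degree f < degree (a i) \<Longrightarrow> ultimately_constant f"
      using \<mu> by (auto simp: minimal_nonconstant_def)
  qed
  then obtain n \<alpha> where n: "\<And>i x. i \<in> S \<Longrightarrow> x \<in> tail_ball (n i) \<Longrightarrow> v (poly (a i) x) = ereal (\<alpha> i)"
    by metis
  \<comment> \<open>The balls shrink as the index grows, so the maximum serves all coefficients at
    once.\<close>
  define N where "N = Max (n ` S)"
  have N: "v (poly (a i) x) = ereal (\<alpha> i)" if "i \<in> S" "x \<in> tail_ball N" for i x
    using that fin by (intro n tail_ball_antimono[OF _ that(2)]) (auto simp: N_def)
  have "ereal (\<alpha> i) \<in> range v" if "i \<in> S" for i
    using N[OF that sequence_in_tail_ball[of N "Suc N"]] by (metis lessI rangeI)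
  moreover have "(\<forall>m. (\<forall>i\<in>S. m \<le> \<alpha> i + real i * y) \<longrightarrow> ereal m \<le> v (poly p x)) \<and>
        (\<forall>i\<in>S. (\<forall>j\<in>S-{i}. \<alpha> i + real i * y < \<alpha> j + real j * y) \<longrightarrow>
           v (poly p x) = ereal (\<alpha> i + real i * y))"
    if x: "x \<in> tail_ball N" and y: "v (poly \<mu> x) = ereal y" for x y
  proof -
    have summand: "v (poly (a i) x * poly \<mu> x ^ i) = ereal (\<alpha> i + real i * y)" if "i \<in> S" for i
      using N[OF that x] v_power[OF y, of i] by (simp add: v_mult)
    have px: "poly p x = (\<Sum>i\<in>S. poly (a i) x * poly \<mu> x ^ i)"
      by (subst pS) (simp add: poly_sum)
    have "ereal m \<le> v (poly p x)" if "\<forall>i\<in>S. m \<le> \<alpha> i + real i * y" for m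
      unfolding px by (rule v_sum_ge[OF fin]) (use that in \<open>simp add: summand\<close>)
    moreover have "v (poly p x) = ereal (\<alpha> i + real i * y)"
      if "i \<in> S" "\<forall>j\<in>S-{i}. \<alpha> i + real i * y < \<alpha> j + real j * y" for i
      unfolding px by (subst v_sum_unique_minimal[OF fin that(1)]) (use that in \<open>auto simp: summand\<close>)
    ultimately show ?thesis by blast
  qed
  ultimately have "tropical_expansion \<mu> p S \<alpha> N"
    unfolding tropical_expansion_def using fin ne by blast
  then show ?thesis by blast
qed

lemma tropical_expansion_ge:
  assumes "tropical_expansion \<mu> p S \<alpha> N" "x \<in> tail_ball N" "v (poly \<mu> x) = ereal y"
    "\<And>i. i \<in> S \<Longrightarrow> m \<le> \<alpha> i + real i * y"
  shows "ereal m \<le> v (poly p x)"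
  using assms unfolding tropical_expansion_def by blast

lemma tropical_expansion_eq:
  assumes "tropical_expansion \<mu> p S \<alpha> N" "x \<in> tail_ball N" "v (poly \<mu> x) = ereal y"
    "i \<in> S" "\<And>j. j \<in> S - {i} \<Longrightarrow> \<alpha> i + real i * y < \<alpha> j + real j * y"
  shows "v (poly p x) = ereal (\<alpha> i + real i * y)"
  using assms unfolding tropical_expansion_def by blast

text \<open>In the nonconstant case the value of \<open>f\<close> follows one dominant tropical
  term; its slope is a natural number, and the values of \<open>\<mu>\<close> increase.\<close>

lemma eventually_v_poly_mono:
  assumes "f \<noteq> 0"
  shows "\<exists>N. \<forall>m n. N \<le> m \<and> m \<le> n \<longrightarrow> v (poly f (t m)) \<le> v (poly f (t n))"
proof (cases "ultimately_constant f")
  case True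
  then show ?thesis
    unfolding ultimately_constant_def eventually_sequentially by (metis order_refl order_trans)
next
  case False
  then obtain \<mu> where \<mu>: "minimal_nonconstant \<mu>"
    using minimal_nonconstant_exists assms by blast
  from minimal_nonconstant_growth[OF \<mu>] obtain g N1 where g: "strict_mono g"
    and N1: "\<And>n. n \<ge> N1 \<Longrightarrow> v (poly \<mu> (t n)) = ereal (g n)" by blast
  from tropical_expansion_exists[OF \<mu> assms] obtain S \<alpha> N2
    where e: "tropical_expansion \<mu> f S \<alpha> N2" by blast
  then have "finite S" "S \<noteq> {}" by (auto simp: tropical_expansion_def)
  from eventually_unique_minimal[OF g this, of \<alpha>] obtain i N3 where i: "i \<in> S"
    and N3: "\<And>n j. n \<ge> N3 \<Longrightarrow> j \<in> S - {i} \<Longrightarrow> \<alpha> i + real i * g n < \<alpha> j + real j * g n" by blast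
  \<comment> \<open>\<open>Suc N2\<close> enters because \<open>t n\<close> lies in
    \<open>tail_ball N2\<close> for \<open>n > N2\<close>.\<close>
  define N where "N = max N1 (max (Suc N2) N3)"
  have val: "v (poly f (t n)) = ereal (\<alpha> i + real i * g n)" if "n \<ge> N" for n
    by (rule tropical_expansion_eq[OF e _ _ i])
      (use that N1 N3 in \<open>auto simp: N_def intro!: sequence_in_tail_ball\<close>)
  have "v (poly f (t m)) \<le> v (poly f (t n))" if "N \<le> m" "m \<le> n" for m n
    using that strict_mono_less_eq[OF g, of m n] by (simp add: val mult_left_mono)
  then show ?thesis by blast
qed

end

section \<open>The value group\<close>

context real_valued_field
begin

lemma value_group_add: "ereal a \<in> range v \<Longrightarrow> ereal b \<in> range v \<Longrightarrow> ereal (a + b) \<in> range v"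
  unfolding image_iff plus_ereal.simps(1)[symmetric] by (metis UNIV_I v_mult)

lemma value_group_nat_mult: "ereal a \<in> range v \<Longrightarrow> ereal (real k * a) \<in> range v"
  by (metis imageE rangeI v_power)

lemma value_group_uminus:
  assumes "ereal a \<in> range v"
  shows "ereal (- a) \<in> range v"
proof -
  obtain c where c: "v c = ereal a" using assms by (metis imageE)
  then have "c \<noteq> 0" by auto
  then obtain b where b: "v (inverse c) = ereal b" using v_finite[of "inverse c"] by auto
  have "v (c * inverse c) = ereal (a + b)" by (simp add: v_mult c b del: right_inverse)
  then have "b = - a" using \<open>c \<noteq> 0\<close> by (simp add: zero_ereal_def)
  then show ?thesis using b by (metis rangeI)
qed

lemma value_group_int_mult:
  assumes "ereal a \<in> range v"
  shows "ereal (real_of_int k * a) \<in> range v"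
  using value_group_nat_mult[OF assms] value_group_uminus
  by (cases k rule: int_cases2) (simp, fastforce)

lemma value_group_diff: "ereal a \<in> range v \<Longrightarrow> ereal b \<in> range v \<Longrightarrow> ereal (a - b) \<in> range v"
  using value_group_add[of a "- b"] value_group_uminus by simp

text \<open>Where two lines cross, the difference of the slopes times \<open>y\<close> is a
  difference of the constants.\<close>

lemma rational_multiple_in_value_group:
  assumes "ereal a \<in> range v" "ereal b \<in> range v" "i \<noteq> j"
    and "a + real i * y = b + real j * y"
  shows "\<exists>k>0. ereal (real k * y) \<in> range v"
proof (cases "i < j")
  case True
  then have "real (j - i) * y = a - b" using assms(4) by (simp add: of_nat_diff algebra_simps)
  then show ?thesis using value_group_diff[OF assms(1,2)] True by (intro exI[of _ "j - i"]) simp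
next
  case False
  then have "real (i - j) * y = b - a" using assms(4) by (simp add: of_nat_diff algebra_simps)
  then show ?thesis using value_group_diff[OF assms(2,1)] False assms(3)
    by (intro exI[of _ "i - j"]) simp
qed

end

section \<open>Inequalities between polynomials near the sequence\<close>

context pseudo_convergent_sequence
begin

text \<open>Density of the divisible hull of the value group in the reals. A difference of gaps
  gives a positive element \<open>d\<close>; for large \<open>k\<close> the interval from
  \<open>real k * a\<close> to \<open>real k * b\<close> is longer than \<open>d\<close> and so
  contains an integer multiple of \<open>d\<close>.\<close>

lemma rational_value_between:
  assumes "a < b"
  shows "\<exists>k>0. \<exists>w. ereal w \<in> range v \<and> real k * a \<le> w \<and> w \<le> real k * b"
proof -
  define d where "d = gap 1 - gap 0"
  have d: "d > 0" by (simp add: d_def)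
  have dG: "ereal d \<in> range v" unfolding d_def using v_step by (metis rangeI value_group_diff)
  obtain k where k: "d < real k * (b - a)"
    using reals_Archimedean3[of "b - a"] assms by auto
  define m where "m = \<lfloor>real k * b / d\<rfloor>"
  have "real_of_int m \<le> real k * b / d" "real k * b / d < real_of_int m + 1"
    by (auto simp: m_def)
  then have "real_of_int m * d \<le> real k * b" "real k * b < real_of_int m * d + d"
    using d by (auto simp: field_simps)
  moreover have "k > 0" using k d by (auto intro!: gr0I)
  ultimately show ?thesis using k value_group_int_mult[OF dG, of m]
    by (intro exI[of _ k] conjI exI[of _ "real_of_int m * d"]) (auto simp: algebra_simps)
qed

text \<open>A condition on a power, with constant in the value group, thus bounds the base by a real
  number possibly outside the value group.\<close>

lemma v_power_le:
  assumes "v (z ^ k) \<le> ereal w" "w \<le> real k * b" "k > 0"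
  shows "v z \<le> ereal b"
proof -
  have "z \<noteq> 0" using assms by (auto simp: power_0_left)
  then obtain y where y: "v z = ereal y" using v_finite by blast
  have "real k * y \<le> w" using assms(1) v_power[OF y, of k] by simp
  also note assms(2)
  finally show ?thesis using y assms(3) by simp
qed

text \<open>The condition on \<open>f\<close> and \<open>c\<close> controls the points where the
  value of \<open>\<mu>\<close> reaches or exceeds its limit along \<open>t\<close>. At roots of
  \<open>\<mu>\<close> that value is infinite and tropical expansions say nothing; \<open>h\<close>
  removes these finitely many points, which every pseudo-convergent sequence ultimately
  avoids.\<close>

lemma v_le_near_sequence:
  assumes p: "p \<noteq> 0" and q: "q \<noteq> 0"
    and le: "\<forall>\<^sub>F n in sequentially. v (poly q (t n)) \<le> v (poly p (t n))"
  shows "\<exists>N f c h. f \<noteq> 0 \<and> c \<noteq> 0 \<and> h \<noteq> 0 \<and>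
    (\<forall>\<^sub>F n in sequentially. v (poly f (t n)) \<le> v c) \<and>
    (\<forall>x\<in>tail_ball N. v (poly f x) \<le> v c \<and> poly h x \<noteq> 0 \<longrightarrow> v (poly q x) \<le> v (poly p x))"
proof (cases "\<exists>f. f \<noteq> 0 \<and> \<not> ultimately_constant f")
  \<comment> \<open>If all nonzero polynomials are ultimately constant, both values are constant on
    a ball, and \<open>f\<close>, \<open>c\<close> and \<open>h\<close> can be 1.\<close>
  case False
  then have "\<exists>N \<gamma>. \<forall>x\<in>tail_ball N. v (poly f x) = ereal \<gamma>" if "f \<noteq> 0" for f
    using that by (intro v_constant_on_tail_ball) auto
  then obtain N1 \<gamma> N2 \<delta> where 1: "\<And>x. x \<in> tail_ball N1 \<Longrightarrow> v (poly p x) = ereal \<gamma>"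
    and 2: "\<And>x. x \<in> tail_ball N2 \<Longrightarrow> v (poly q x) = ereal \<delta>"
    using p q by metis
  obtain N3 where 3: "\<And>n. n \<ge> N3 \<Longrightarrow> v (poly q (t n)) \<le> v (poly p (t n))"
    using le by (auto simp: eventually_sequentially)
  define m where "m = Suc (max N1 (max N2 N3))"
  have "\<delta> \<le> \<gamma>"
    using 3[of m] 1[of "t m"] 2[of "t m"] sequence_in_tail_ball[of _ m] by (auto simp: m_def)
  then have "\<forall>x\<in>tail_ball (max N1 N2). v (poly q x) \<le> v (poly p x)"
    using 1 2 by (metis ereal_less_eq(3) max.cobounded1 max.cobounded2 tail_ball_antimono)
  then show ?thesis
    by (intro exI[of _ "max N1 N2"] exI[of _ 1]) simp
next
  case True
  then obtain \<mu> where \<mu>: "minimal_nonconstant \<mu>"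
    using minimal_nonconstant_exists by blast
  then have "\<mu> \<noteq> 0" by (simp add: minimal_nonconstant_def)
  from minimal_nonconstant_growth[OF \<mu>] obtain g N1 where g: "strict_mono g"
    and N1: "\<And>n. n \<ge> N1 \<Longrightarrow> v (poly \<mu> (t n)) = ereal (g n)"
    and N1': "\<And>n x. n \<ge> N1 \<Longrightarrow> x \<in> tail_ball n \<Longrightarrow> ereal (g n) \<le> v (poly \<mu> x)" by blast
  from tropical_expansion_exists[OF \<mu> p] obtain S \<alpha> N2
    where ep: "tropical_expansion \<mu> p S \<alpha> N2" by blast
  from tropical_expansion_exists[OF \<mu> q] obtain T \<beta> N3
    where eq: "tropical_expansion \<mu> q T \<beta> N3" by blast
  have S: "finite S" "S \<noteq> {}" "\<And>i. i \<in> S \<Longrightarrow> ereal (\<alpha> i) \<in> range v"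
    and T: "finite T" "T \<noteq> {}" "\<And>i. i \<in> T \<Longrightarrow> ereal (\<beta> i) \<in> range v"
    using ep eq by (auto simp: tropical_expansion_def)
  from eventually_unique_minimal[OF g S(1,2), of \<alpha>] obtain i N4 where i: "i \<in> S"
    and N4: "\<And>n j. n \<ge> N4 \<Longrightarrow> j \<in> S - {i} \<Longrightarrow> \<alpha> i + real i * g n < \<alpha> j + real j * g n" by blast
  from eventually_unique_minimal[OF g T(1,2), of \<beta>] obtain k N5 where k: "k \<in> T"
    and N5: "\<And>n j. n \<ge> N5 \<Longrightarrow> j \<in> T - {k} \<Longrightarrow> \<beta> k + real k * g n < \<beta> j + real j * g n" by blast
  obtain N6 where N6: "\<And>n. n \<ge> N6 \<Longrightarrow> v (poly q (t n)) \<le> v (poly p (t n))"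
    using le by (auto simp: eventually_sequentially)
  define N where "N = Suc (max (max N1 N2) (max (max N3 N4) (max N5 N6)))"
  have Nle: "N1 < N" "N2 < N" "N3 < N" "N4 < N" "N5 < N" "N6 < N" by (auto simp: N_def)
  \<comment> \<open>\<open>dom y\<close> says that the terms dominating along the sequence still
    dominate at \<open>y\<close> and compare correctly. As a conjunction of linear inequalities it
    holds between any two points where it holds.\<close>
  define dom where "dom y \<longleftrightarrow> (\<forall>j\<in>S-{i}. \<alpha> i + real i * y < \<alpha> j + real j * y) \<and>
    (\<forall>j\<in>T-{k}. \<beta> k + real k * y < \<beta> j + real j * y) \<and> \<beta> k + real k * y \<le> \<alpha> i + real i * y" for y
  have vp: "v (poly p x) = ereal (\<alpha> i + real i * y)"
    and vq: "v (poly q x) = ereal (\<beta> k + real k * y)"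
    if "x \<in> tail_ball N2" "x \<in> tail_ball N3" "v (poly \<mu> x) = ereal y"
      "\<forall>j\<in>S-{i}. \<alpha> i + real i * y < \<alpha> j + real j * y"
      "\<forall>j\<in>T-{k}. \<beta> k + real k * y < \<beta> j + real j * y" for x y
    using tropical_expansion_eq[OF ep that(1,3) i] tropical_expansion_eq[OF eq that(2,3) k] that(4,5)
    by auto
  have t_ball: "t n \<in> tail_ball N2" "t n \<in> tail_ball N3" if "n \<ge> N" for n
    using Nle that by (auto intro: sequence_in_tail_ball)
  have vqt: "v (poly q (t n)) = ereal (\<beta> k + real k * g n)" if "n \<ge> N" for n
    using that Nle N1 N4 N5 by (intro vq t_ball) auto
  have dom_g: "dom (g n)" if "n \<ge> N" for n
    using vp[OF t_ball[OF that] N1[of n]] vqt[OF that] N4[of n] N5[of n] N6[of n] that Nle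
    by (auto simp: dom_def)
  have dom_between: "dom y" if "g N \<le> y" "y \<le> g n" "n \<ge> N" for y n
    using dom_g[of N] dom_g[OF that(3)] that(1,2) unfolding dom_def
    by (auto intro: affine_less_between affine_le_between)
  have conclude: "v (poly q x) \<le> v (poly p x)"
    if "x \<in> tail_ball N" "v (poly \<mu> x) = ereal y" "dom y" for x y
    using vp[of x y] vq[of x y] that Nle tail_ball_antimono[OF _ that(1)]
    by (auto simp: dom_def less_imp_le)
  have value_ge: "\<exists>y. v (poly \<mu> x) = ereal y \<and> g N \<le> y"
    if "x \<in> tail_ball N" "poly \<mu> x \<noteq> 0" for x
    using N1'[of N x] that Nle v_finite[OF that(2)] by auto
  show ?thesis
  proof (cases "\<exists>b. \<forall>n. g n \<le> b")
    \<comment> \<open>For unbounded \<open>g\<close>, every finite value of \<open>\<mu>\<close> on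
      the ball lies between \<open>g N\<close> and some \<open>g n\<close>, so \<open>f\<close> and
      \<open>c\<close> can be 1.\<close>
    case False
    have "v (poly q x) \<le> v (poly p x)" if x: "x \<in> tail_ball N" "poly \<mu> x \<noteq> 0" for x
    proof -
      obtain y where y: "v (poly \<mu> x) = ereal y" "g N \<le> y" using value_ge[OF x] by blast
      obtain n where "y < g n" using False by (meson not_le)
      then have "y \<le> g (max n N)" using strict_mono_less_eq[OF g, of n "max n N"] by simp
      then show ?thesis using conclude[OF x(1) y(1)] dom_between[OF y(2)] by simp
    qed
    then show ?thesis using \<open>\<mu> \<noteq> 0\<close>
      by (intro exI[of _ N] exI[of _ 1] exI[of _ 1] exI[of _ \<mu>]) simp
  next
    case True
    have inc: "incseq g" using g by (rule strict_mono_mono)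
    from True obtain b where "\<And>n. g n \<le> b" by blast
    with incseq_convergent[OF inc] obtain l where lim: "g \<longlonglongrightarrow> l" and gl: "\<And>n. g n \<le> l"
      by blast
    have limit: "(\<lambda>n. a + real j * g n) \<longlonglongrightarrow> a + real j * l" for a j
      by (intro tendsto_intros lim)
    \<comment> \<open>The limits of the values of \<open>p\<close> and \<open>q\<close> along
      \<open>t\<close>. They remain minimal among the terms at \<open>l\<close>, though perhaps not
      uniquely.\<close>
    define P Q where "P = \<alpha> i + real i * l" and "Q = \<beta> k + real k * l"
    have QP: "Q \<le> P"
      unfolding P_def Q_def
      by (rule LIMSEQ_le[OF limit limit]) (use dom_g in \<open>auto simp: dom_def\<close>)
    have PS: "P \<le> \<alpha> j + real j * l" if "j \<in> S" for j
    proof (cases "j = i")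
      case False
      have "\<alpha> i + real i * g n \<le> \<alpha> j + real j * g n" if "n \<ge> N" for n
        using dom_g[OF that] \<open>j \<in> S\<close> False by (simp add: dom_def less_imp_le)
      then show ?thesis unfolding P_def
        by (intro LIMSEQ_le[OF limit limit] exI[of _ N]) simp
    qed (simp add: P_def)
    have QT: "Q \<le> \<beta> j + real j * l" if "j \<in> T" for j
    proof (cases "j = k")
      case False
      have "\<beta> k + real k * g n \<le> \<beta> j + real j * g n" if "n \<ge> N" for n
        using dom_g[OF that] \<open>j \<in> T\<close> False by (simp add: dom_def less_imp_le)
      then show ?thesis unfolding Q_def
        by (intro LIMSEQ_le[OF limit limit] exI[of _ N]) simp
    qed (simp add: Q_def)
    have below: "v (poly q x) \<le> v (poly p x)"
      if x: "x \<in> tail_ball N" and y: "v (poly \<mu> x) = ereal y" "g N \<le> y" and "y < l" for x y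
    proof -
      from order_tendstoD(1)[OF lim \<open>y < l\<close>] obtain n where "y < g n"
        by (auto simp: eventually_sequentially)
      then have "y \<le> g (max n N)" using strict_mono_less_eq[OF g, of n "max n N"] by simp
      then show ?thesis using conclude[OF x y(1)] dom_between[OF y(2)] by simp
    qed
    show ?thesis
    proof (cases "\<exists>e>0. \<exists>w. ereal w \<in> range v \<and> real e * Q \<le> w \<and> w \<le> real e * P")
      \<comment> \<open>Take \<open>f = q ^ e\<close>. Along the sequence \<open>q\<close> has value
        at most \<open>Q\<close>, so \<open>f\<close> has value at most \<open>w\<close>.
        Conversely, the condition bounds the value of \<open>q\<close> by \<open>P\<close>, and for
        \<open>y \<ge> l\<close> all terms of \<open>p\<close> are at least
        \<open>P\<close>.\<close>
      case True
      then obtain e c w where e: "e > 0" and c: "v c = ereal w"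
        and w: "real e * Q \<le> w" "w \<le> real e * P" by (metis imageE)
      have "v (poly (q ^ e) (t n)) \<le> v c" if "n \<ge> N" for n
      proof -
        have "\<beta> k + real k * g n \<le> Q"
          unfolding Q_def using gl[of n] by (simp add: mult_left_mono)
        then have "real e * (\<beta> k + real k * g n) \<le> w"
          using w(1) by (meson mult_left_mono of_nat_0_le_iff order_trans)
        then show ?thesis using v_power[OF vqt[OF that], of e] c by simp
      qed
      moreover have "v (poly q x) \<le> v (poly p x)"
        if x: "x \<in> tail_ball N" and le: "v (poly (q ^ e) x) \<le> v c" and h: "poly \<mu> x \<noteq> 0" for x
      proof -
        obtain y where y: "v (poly \<mu> x) = ereal y" "g N \<le> y" using value_ge[OF x h] by blast
        show ?thesis
        proof (cases "y < l")
          case False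
          then have "P \<le> \<alpha> j + real j * y" if "j \<in> S" for j
            using PS[OF that] mult_left_mono[of l y "real j"] by simp
          then have "ereal P \<le> v (poly p x)"
            using tropical_expansion_ge[OF ep tail_ball_antimono[OF _ x] y(1)] Nle by simp
          moreover have "v (poly q x) \<le> ereal P"
            using v_power_le[OF _ w(2) e, of "poly q x"] le c by simp
          ultimately show ?thesis by (rule order_trans[rotated])
        qed (rule below[OF x y])
      qed
      moreover have "c \<noteq> 0" using c by auto
      ultimately show ?thesis using \<open>\<mu> \<noteq> 0\<close> q
        by (intro exI[of _ N] exI[of _ "q ^ e"] exI[of _ c] exI[of _ \<mu>])
          (auto simp: eventually_sequentially)
    next
      case False
      text \<open>Then no positive multiple of \<open>l\<close> lies in the value group, so dominance persists at \<open>l\<close>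
        and it suffices to bound \<open>\<mu>\<close> slightly above \<open>l\<close>.\<close>
      from False have no_w: "\<not> w \<le> real e * P"
        if "e > 0" "ereal w \<in> range v" "real e * Q \<le> w" for e w
        using that by (meson)
      have no_P: "ereal (real e * P) \<notin> range v" if "e > 0" for e
        using no_w[OF that, of "real e * P"] mult_left_mono[OF QP, of "real e"] by auto
      \<comment> \<open>By density, some fraction \<open>w / e\<close> would separate
        \<open>Q < P\<close>.\<close>
      have PQ: "P = Q"
      proof (rule ccontr)
        assume "P \<noteq> Q"
        then have "Q < P" using QP by simp
        from rational_value_between[OF this] show False using no_w by metis
      qed
      have no_l: "ereal (real e * l) \<notin> range v" if "e > 0" for e
      proof
        assume "ereal (real e * l) \<in> range v"
        then have "ereal (real e * \<alpha> i + real i * (real e * l)) \<in> range v"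
          using S(3)[OF i] value_group_add[of "real e * \<alpha> i" "real i * (real e * l)"]
          by (simp add: value_group_nat_mult)
        also have "real e * \<alpha> i + real i * (real e * l) = real e * P"
          by (simp add: P_def algebra_simps)
        finally show False using no_P[OF that] by blast
      qed
      have distinct: "a + real j * l \<noteq> b + real m * l"
        if "ereal a \<in> range v" "ereal b \<in> range v" "j \<noteq> m" for a b j m
        using rational_multiple_in_value_group[OF that, of l] no_l by blast
      \<comment> \<open>Lines of distinct slopes crossing at \<open>l\<close> would put a multiple
        of \<open>l\<close> into the value group. With equal slopes the comparison of the dominant
        terms reduces to their constants and holds at every \<open>y\<close>.\<close>
      have "i = k"
        using distinct[OF S(3)[OF i] T(3)[OF k]] PQ by (auto simp: P_def Q_def)
      then have "\<beta> k \<le> \<alpha> i" using PQ by (simp add: P_def Q_def)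
      have lessS: "\<alpha> i + real i * l < \<alpha> j + real j * l" if "j \<in> S - {i}" for j
      proof -
        have "\<alpha> i + real i * l \<noteq> \<alpha> j + real j * l" using that i by (intro distinct S(3)) auto
        then show ?thesis using PS[of j] that by (simp add: P_def)
      qed
      have lessT: "\<beta> k + real k * l < \<beta> j + real j * l" if "j \<in> T - {k}" for j
      proof -
        have "\<beta> k + real k * l \<noteq> \<beta> j + real j * l" using that k by (intro distinct T(3)) auto
        then show ?thesis using QT[of j] that by (simp add: Q_def)
      qed
      have near: "\<forall>\<^sub>F y in nhds l. a + real j * y < b + real m * y"
        if "a + real j * l < b + real m * l" for a b j m
      proof -
        have "((\<lambda>y. (b + real m * y) - (a + real j * y)) \<longlongrightarrow> (b + real m * l) - (a + real j * l)) (nhds l)"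
          by (intro tendsto_intros filterlim_ident)
        from order_tendstoD(1)[OF this, of 0] show ?thesis using that by simp
      qed
      have "\<forall>\<^sub>F y in nhds l. (\<forall>j\<in>S-{i}. \<alpha> i + real i * y < \<alpha> j + real j * y) \<and>
          (\<forall>j\<in>T-{k}. \<beta> k + real k * y < \<beta> j + real j * y)"
        using S(1) T(1) lessS lessT near
        by (intro eventually_conj eventually_ball_finite) auto
      then obtain \<epsilon> where \<epsilon>: "\<epsilon> > 0" and dom: "\<And>y. dist y l < \<epsilon> \<Longrightarrow> dom y"
        unfolding eventually_nhds_metric dom_def using \<open>i = k\<close> \<open>\<beta> k \<le> \<alpha> i\<close> by auto
      \<comment> \<open>The bound \<open>w / e\<close> on the value of \<open>\<mu>\<close> lies
        above \<open>l\<close>, so it holds along the sequence, and below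
        \<open>l + \<epsilon>\<close>, so values from \<open>l\<close> up to it satisfy
        \<open>dom\<close>.\<close>
      have "l + \<epsilon> / 3 < l + \<epsilon> / 2" using \<epsilon> by simp
      from rational_value_between[OF this] obtain e c w where e: "e > 0" and c: "v c = ereal w"
        and w: "real e * (l + \<epsilon> / 3) \<le> w" "w \<le> real e * (l + \<epsilon> / 2)"
        by (metis imageE)
      have "v (poly (\<mu> ^ e) (t n)) \<le> v c" if "n \<ge> N" for n
      proof -
        have "g n \<le> l + \<epsilon> / 3" using gl[of n] \<epsilon> by simp
        then have "real e * g n \<le> w"
          using w(1) by (meson mult_left_mono of_nat_0_le_iff order_trans)
        then show ?thesis using v_power[OF N1[of n], of e] c that Nle by simp
      qed
      moreover have "v (poly q x) \<le> v (poly p x)"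
        if x: "x \<in> tail_ball N" and le: "v (poly (\<mu> ^ e) x) \<le> v c" and h: "poly \<mu> x \<noteq> 0" for x
      proof -
        obtain y where y: "v (poly \<mu> x) = ereal y" "g N \<le> y" using value_ge[OF x h] by blast
        show ?thesis
        proof (cases "y < l")
          case False
          moreover have "y \<le> l + \<epsilon> / 2"
            using v_power_le[OF _ w(2) e, of "poly \<mu> x"] le c y(1) by simp
          ultimately show ?thesis using \<epsilon> by (intro conclude[OF x y(1)] dom) (simp add: dist_real_def)
        qed (rule below[OF x y])
      qed
      moreover have "c \<noteq> 0" using c by auto
      ultimately show ?thesis using \<open>\<mu> \<noteq> 0\<close>
        by (intro exI[of _ N] exI[of _ "\<mu> ^ e"] exI[of _ c] exI[of _ \<mu>])
          (auto simp: eventually_sequentially)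
    qed
  qed
qed

end

section \<open>Countable bases of clopen sets\<close>

text \<open>Send a point to its pattern of memberships in \<open>\<B>\<close>. Clopenness makes this
  map continuous, \<open>base\<close> makes it open onto its image, and \<open>base\<close> with the
  T0 axiom makes it injective.\<close>

lemma metrizable_space_countable_clopen_base:
  fixes X :: "'b topology"
  assumes "countable \<B>" and "t0_space X"
    and clopen: "\<And>B. B \<in> \<B> \<Longrightarrow> openin X B" "\<And>B. B \<in> \<B> \<Longrightarrow> closedin X B"
    and base: "\<And>U x. openin X U \<Longrightarrow> x \<in> U \<Longrightarrow>
      \<exists>J\<subseteq>\<B>. finite J \<and> (\<forall>y\<in>topspace X. (\<forall>B\<in>J. y \<in> B \<longleftrightarrow> x \<in> B) \<longrightarrow> y \<in> U)"
  shows "metrizable_space X"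
proof -
  define Y where "Y = product_topology (\<lambda>_. discrete_topology (UNIV :: bool set)) \<B>"
  define e where "e x = (\<lambda>B\<in>\<B>. x \<in> B)" for x
  have "metrizable_space Y"
    unfolding Y_def metrizable_space_product_topology using \<open>countable \<B>\<close>
    by (auto intro: countable_subset[OF _ \<open>countable \<B>\<close>])
  then have "metrizable_space (subtopology Y (e ` topspace X))"
    by (rule metrizable_space_subtopology)
  have e_Y: "e ` topspace X \<subseteq> topspace Y"
    by (auto simp: Y_def e_def)
  have "continuous_map X Y e"
    unfolding Y_def continuous_map_componentwise
  proof (intro conjI ballI)
    fix B assume "B \<in> \<B>"
    have "openin X {x \<in> topspace X. e x B \<in> S}" for S
    proof -
      have "{x \<in> topspace X. e x B \<in> S} =
          (if True \<in> S then B else {}) \<union> (if False \<in> S then topspace X - B else {})"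
        using openin_subset[OF clopen(1)[OF \<open>B \<in> \<B>\<close>]] \<open>B \<in> \<B>\<close>
        by (auto simp: e_def) (metis (full_types))+
      then show ?thesis using clopen[OF \<open>B \<in> \<B>\<close>] by (auto simp: closedin_def)
    qed
    then show "continuous_map X (discrete_topology UNIV) (\<lambda>x. e x B)"
      by (simp add: continuous_map_def)
  qed (auto simp: e_def)
  moreover have "open_map X (subtopology Y (e ` topspace X)) e"
    unfolding open_map_def
  proof (intro allI impI)
    fix U assume U: "openin X U"
    then have "\<exists>J\<subseteq>\<B>. finite J \<and> (\<forall>y\<in>topspace X. (\<forall>B\<in>J. y \<in> B \<longleftrightarrow> x \<in> B) \<longrightarrow> y \<in> U)"
      if "x \<in> U" for x
      using base that by blast
    then obtain J where J: "\<And>x. x \<in> U \<Longrightarrow> J x \<subseteq> \<B>" "\<And>x. x \<in> U \<Longrightarrow> finite (J x)"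
      "\<And>x y. x \<in> U \<Longrightarrow> y \<in> topspace X \<Longrightarrow> \<forall>B\<in>J x. y \<in> B \<longleftrightarrow> x \<in> B \<Longrightarrow> y \<in> U"
      by metis
    \<comment> \<open>The cylinder of patterns that agree with that of \<open>x\<close> on
      \<open>J x\<close>; only finitely many coordinates are restricted.\<close>
    define W where "W x = PiE \<B> (\<lambda>B. if B \<in> J x then {x \<in> B} else UNIV)" for x
    have "openin Y (W x)" if "x \<in> U" for x
      unfolding Y_def W_def openin_PiE_gen
      using J(2)[OF that] by (auto intro: finite_subset[of _ "J x"])
    then have "openin Y (\<Union>x\<in>U. W x)" by blast
    moreover have "e ` U = (\<Union>x\<in>U. W x) \<inter> e ` topspace X"
    proof (intro equalityI subsetI)
      fix h assume "h \<in> e ` U"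
      then obtain x where "x \<in> U" "h = e x" by blast
      moreover have "e x \<in> W x" by (auto simp: e_def W_def)
      ultimately show "h \<in> (\<Union>x\<in>U. W x) \<inter> e ` topspace X"
        using openin_subset[OF U] by blast
    next
      fix h assume "h \<in> (\<Union>x\<in>U. W x) \<inter> e ` topspace X"
      then obtain x y where x: "x \<in> U" and y: "y \<in> topspace X" "h = e y" and W: "e y \<in> W x" by blast
      have "(y \<in> B) = (x \<in> B)" if "B \<in> J x" for B
        using PiE_mem[OF W[unfolded W_def], of B] that J(1)[OF x] by (auto simp: e_def)
      then show "h \<in> e ` U" using J(3)[OF x y(1)] y(2) by blast
    qed
    ultimately show "openin (subtopology Y (e ` topspace X)) (e ` U)"
      by (auto simp: openin_subtopology)
  qed
  moreover have "inj_on e (topspace X)"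
  proof (rule inj_onI, rule ccontr)
    fix x y assume x: "x \<in> topspace X" and y: "y \<in> topspace X" and eq: "e x = e y" and "x \<noteq> y"
    then obtain U where U: "openin X U" "x \<in> U \<longleftrightarrow> y \<notin> U"
      using \<open>t0_space X\<close> unfolding t0_space_def by meson
    have same: "x \<in> B \<longleftrightarrow> y \<in> B" if "B \<in> \<B>" for B
      using fun_cong[OF eq, of B] that by (simp add: e_def)
    show False
    proof (cases "x \<in> U")
      case True
      then show False using base[OF U(1) True] same y U(2) by blast
    next
      case False
      then have "y \<in> U" using U(2) by blast
      then show False using base[OF U(1) \<open>y \<in> U\<close>] same x U(2) by blast
    qed
  qed
  ultimately have "homeomorphic_map X (subtopology Y (e ` topspace X)) e"
    using e_Y by (intro bijective_open_imp_homeomorphic_map)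
      (auto simp: continuous_map_in_subtopology Int_absorb1)
  then have "X homeomorphic_space subtopology Y (e ` topspace X)"
    by (rule homeomorphic_map_imp_homeomorphic_space)
  then show ?thesis
    using homeomorphic_metrizable_space \<open>metrizable_space (subtopology Y (e ` topspace X))\<close> by blast
qed

section \<open>Countability of the field and its polynomials\<close>

lemma valuation_domain_countable_field:
  fixes V :: "'a::field set"
  assumes "valuation_domain V" "countable V"
  shows "countable (UNIV :: 'a set)"
proof (rule countable_subset)
  show "UNIV \<subseteq> insert 0 (V \<union> inverse ` V)"
  proof
    fix x :: 'a
    have "x \<in> V \<or> inverse x \<in> V" if "x \<noteq> 0"
      using assms(1) that by (auto simp: valuation_domain_def)
    moreover have "x \<in> inverse ` V" if "inverse x \<in> V"
      using imageI[OF that, of inverse] by simp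
    ultimately show "x \<in> insert 0 (V \<union> inverse ` V)" by blast
  qed
qed (use assms(2) in simp)

lemma countable_poly:
  assumes "countable (UNIV :: 'a::zero set)"
  shows "countable (UNIV :: 'a poly set)"
proof (rule countable_subset)
  show "(UNIV :: 'a poly set) \<subseteq> Poly ` lists UNIV"
  proof
    fix p :: "'a poly"
    show "p \<in> Poly ` lists UNIV" by (rule image_eqI[of _ _ "coeffs p"]) simp_all
  qed
  show "countable (Poly ` lists (UNIV :: 'a set))"
    using assms by blast
qed

section \<open>The Zariski topology\<close>

text \<open>Roots of \<open>q\<close>, where \<open>rat_eval\<close> may be unspecified, occur only
  for finitely many \<open>n\<close>.\<close>

lemma (in pseudo_convergent_sequence) Fract_in_V_dom:
  assumes "q \<noteq> 0"
  shows "Fract p q \<in> V_dom (valuation_ring v) t \<longleftrightarrow>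
    (\<forall>\<^sub>F n in sequentially. v (poly q (t n)) \<le> v (poly p (t n)))"
  unfolding V_dom_def mem_Collect_eq
  by (rule eventually_cong[OF eventually_poly_nonzero[OF assms]])
    (simp add: rat_eval_Fract valuation_ring_def v_divide)

context real_valued_field
begin

text \<open>For \<open>f \<noteq> 0\<close> and \<open>W\<close> given by \<open>t\<close>,
  membership means \<open>v (poly f (t n)) \<le> v c\<close> for almost all
  \<open>n\<close>.\<close>

definition level_set :: "'a poly \<Rightarrow> 'a \<Rightarrow> 'a poly fract set set" where
  "level_set f c = {W \<in> V_space v. Fract [:c:] f \<in> W}"

lemma V_space_cases:
  assumes "W \<in> V_space v"
  obtains t where "pseudo_convergent_sequence v t" "W = V_dom (valuation_ring v) t"
  using assms real_valued_field_axioms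
  by (auto simp: V_space_def pseudo_convergent_sequence_def pseudo_convergent_sequence_axioms_def)

lemma topspace_zariski: "topspace (zariski_topology (V_space v)) = V_space v"
proof -
  have "Fract 1 1 \<in> W" if W: "W \<in> V_space v" for W
  proof -
    obtain t where "pseudo_convergent_sequence v t" and Wt: "W = V_dom (valuation_ring v) t"
      using V_space_cases[OF W] .
    then interpret pseudo_convergent_sequence v t by simp
    show ?thesis unfolding Wt by (subst Fract_in_V_dom) simp_all
  qed
  then show ?thesis by (auto simp: zariski_topology_def)
qed

lemma openin_zariski_basis: "openin (zariski_topology (V_space v)) {W \<in> V_space v. \<phi> \<in> W}"
  unfolding zariski_topology_def by (rule topology_generated_by_Basis) blast

lemma openin_level_set: "openin (zariski_topology (V_space v)) (level_set f c)"
  unfolding level_set_def by (rule openin_zariski_basis)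

text \<open>The values of a polynomial along a pseudo-convergent sequence are ultimately nondecreasing,
  so if they are not ultimately at most \<open>v c\<close>, they are ultimately at least some \<open>v c' > v c\<close>.\<close>

lemma not_in_level_set:
  assumes "W \<in> V_space v" "f \<noteq> 0" "c \<noteq> 0"
  shows "W \<notin> level_set f c \<longleftrightarrow> (\<exists>c'. v c < v c' \<and> c' \<noteq> 0 \<and> Fract f [:c':] \<in> W)"
proof -
  obtain t where "pseudo_convergent_sequence v t" and Wt: "W = V_dom (valuation_ring v) t"
    using V_space_cases[OF assms(1)] .
  then interpret pseudo_convergent_sequence v t by simp
  have level: "W \<in> level_set f c \<longleftrightarrow> (\<forall>\<^sub>F n in sequentially. v (poly f (t n)) \<le> v c)"
    using assms(1) Fract_in_V_dom[OF assms(2), of "[:c:]"] by (simp add: level_set_def Wt)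
  have above: "Fract f [:c':] \<in> W \<longleftrightarrow> (\<forall>\<^sub>F n in sequentially. v c' \<le> v (poly f (t n)))"
    if "c' \<noteq> 0" for c'
    using Fract_in_V_dom[of "[:c':]" f] that by (simp add: Wt)
  show ?thesis
  proof
    assume not: "W \<notin> level_set f c"
    obtain N where N: "\<And>m n. N \<le> m \<Longrightarrow> m \<le> n \<Longrightarrow> v (poly f (t m)) \<le> v (poly f (t n))"
      using eventually_v_poly_mono[OF assms(2)] by blast
    obtain N' where N': "\<And>n. n \<ge> N' \<Longrightarrow> poly f (t n) \<noteq> 0"
      using eventually_poly_nonzero[OF assms(2)] by (auto simp: eventually_sequentially)
    \<comment> \<open>The witness \<open>c'\<close> is the value of \<open>f\<close> at a late term:
      by monotonicity its valuation bounds all later ones from below, and \<open>m \<ge> N'\<close>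
      makes it nonzero.\<close>
    obtain m where m: "m \<ge> max N N'" "v c < v (poly f (t m))"
      using not unfolding level eventually_sequentially by (meson not_le)
    then have "Fract f [:poly f (t m):] \<in> W"
      using N[of m] N'[of m] above by (auto simp: eventually_sequentially)
    then show "\<exists>c'. v c < v c' \<and> c' \<noteq> 0 \<and> Fract f [:c':] \<in> W"
      using m N'[of m] by auto
  next
    assume "\<exists>c'. v c < v c' \<and> c' \<noteq> 0 \<and> Fract f [:c':] \<in> W"
    then obtain c' where "v c < v c'" "\<forall>\<^sub>F n in sequentially. v c' \<le> v (poly f (t n))"
      using above by blast
    then have ev: "\<forall>\<^sub>F n in sequentially. v c < v (poly f (t n))"
      by (auto elim!: eventually_mono)
    show "W \<notin> level_set f c"
    proof
      assume "W \<in> level_set f c"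
      with ev have "\<forall>\<^sub>F n in sequentially. False"
        unfolding level by eventually_elim simp
      then show False by simp
    qed
  qed
qed

text \<open>By \<open>not_in_level_set\<close> the complement is a union of subbasic open
  sets.\<close>

lemma closedin_level_set:
  assumes "f \<noteq> 0" "c \<noteq> 0"
  shows "closedin (zariski_topology (V_space v)) (level_set f c)"
proof -
  have "V_space v - level_set f c =
      (\<Union>c'\<in>{c'. v c < v c' \<and> c' \<noteq> 0}. {W \<in> V_space v. Fract f [:c':] \<in> W})"
    using not_in_level_set[OF _ assms] by auto
  also have "openin (zariski_topology (V_space v)) \<dots>"
    by (intro openin_Union) (auto intro: openin_zariski_basis)
  finally show ?thesis
    by (simp add: closedin_def topspace_zariski) (auto simp: level_set_def)
qed

text \<open>For \<open>p \<noteq> 0\<close> two level sets suffice: membership in one is the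
  condition on \<open>f\<close> and \<open>c\<close> from \<open>v_le_near_sequence\<close>, and
  non-membership in the other encodes the ball.\<close>

lemma level_sets_refine_basis:
  assumes W: "W \<in> V_space v" and "\<phi> \<in> W"
  shows "\<exists>J\<subseteq>{level_set f c | f c. f \<noteq> 0 \<and> c \<noteq> 0}. finite J \<and>
    (\<forall>W'\<in>V_space v. (\<forall>B\<in>J. W' \<in> B \<longleftrightarrow> W \<in> B) \<longrightarrow> \<phi> \<in> W')"
proof -
  obtain p q where \<phi>: "\<phi> = Fract p q" and q: "q \<noteq> 0" by (cases \<phi>)
  obtain t where "pseudo_convergent_sequence v t" and Wt: "W = V_dom (valuation_ring v) t"
    using V_space_cases[OF W] .
  then interpret t: pseudo_convergent_sequence v t by simp
  show ?thesis
  proof (cases "p = 0")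
    case True
    have "\<phi> \<in> W'" if W': "W' \<in> V_space v" for W'
    proof -
      obtain u where "pseudo_convergent_sequence v u" and Wu: "W' = V_dom (valuation_ring v) u"
        using V_space_cases[OF W'] .
      then interpret u: pseudo_convergent_sequence v u by simp
      show ?thesis unfolding \<phi> Wu u.Fract_in_V_dom[OF q] True by simp
    qed
    then show ?thesis by (intro exI[of _ "{}"]) simp
  next
    case False
    have "\<forall>\<^sub>F n in sequentially. v (poly q (t n)) \<le> v (poly p (t n))"
      using \<open>\<phi> \<in> W\<close> unfolding \<phi> Wt t.Fract_in_V_dom[OF q] .
    from t.v_le_near_sequence[OF False q this] obtain N f c h where
      nz: "f \<noteq> 0" "c \<noteq> 0" "h \<noteq> 0" and fc: "\<forall>\<^sub>F n in sequentially. v (poly f (t n)) \<le> v c"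
      and le: "\<And>x. x \<in> t.tail_ball N \<Longrightarrow> v (poly f x) \<le> v c \<Longrightarrow> poly h x \<noteq> 0 \<Longrightarrow>
        v (poly q x) \<le> v (poly p x)" by blast
    \<comment> \<open>\<open>tail_ball N\<close> is given by a strict lower bound
      \<open>v d < v (poly b x)\<close>, so it corresponds to the complement of
      \<open>level_set b d\<close>.\<close>
    define b d where "b = [:- t (Suc N), 1:]" and "d = t (Suc N) - t N"
    have b: "b \<noteq> 0" and d: "d \<noteq> 0"
      using t.v_step[of N] by (auto simp: b_def d_def)
    have ball: "x \<in> t.tail_ball N \<longleftrightarrow> v d < v (poly b x)" for x
      by (simp add: t.tail_ball_def b_def d_def t.v_step)
    have level: "W' \<in> level_set f' c' \<longleftrightarrow> (\<forall>\<^sub>F n in sequentially. v (poly f' (u n)) \<le> v c')"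
      if "W' \<in> V_space v" "pseudo_convergent_sequence v u" "W' = V_dom (valuation_ring v) u" "f' \<noteq> 0"
      for W' u f' c'
      using that pseudo_convergent_sequence.Fract_in_V_dom[OF that(2,4), of "[:c':]"]
      by (simp add: level_set_def)
    have W1: "W \<in> level_set f c"
      using level[OF W t.pseudo_convergent_sequence_axioms Wt nz(1)] fc by simp
    have ev: "\<forall>\<^sub>F n in sequentially. v d < v (poly b (t n))"
      using t.sequence_in_tail_ball[of N] ball
      by (auto simp: eventually_sequentially Suc_le_eq intro!: exI[of _ "Suc N"])
    have W2: "W \<notin> level_set b d"
    proof
      assume "W \<in> level_set b d"
      with ev have "\<forall>\<^sub>F n in sequentially. False"
        unfolding level[OF W t.pseudo_convergent_sequence_axioms Wt b] by eventually_elim simp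
      then show False by simp
    qed
    have "\<phi> \<in> W'" if W': "W' \<in> V_space v" and 1: "W' \<in> level_set f c" and 2: "W' \<notin> level_set b d" for W'
    proof -
      obtain u where u: "pseudo_convergent_sequence v u" and Wu: "W' = V_dom (valuation_ring v) u"
        using V_space_cases[OF W'] .
      then interpret u: pseudo_convergent_sequence v u by simp
      \<comment> \<open>Non-membership by itself yields \<open>v d < v (poly b (u n))\<close> only
        for infinitely many \<open>n\<close>; the bound by \<open>c'\<close> yields it for almost
        all.\<close>
      obtain c' where c': "v d < v c'" "c' \<noteq> 0" "Fract b [:c':] \<in> W'"
        using 2 not_in_level_set[OF W' b d] by blast
      then have "\<forall>\<^sub>F n in sequentially. v c' \<le> v (poly b (u n))"
        using u.Fract_in_V_dom[of "[:c':]" b] by (simp add: Wu)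
      moreover have "\<forall>\<^sub>F n in sequentially. v (poly f (u n)) \<le> v c"
        using 1 level[OF W' u Wu nz(1)] by simp
      ultimately have "\<forall>\<^sub>F n in sequentially. v (poly q (u n)) \<le> v (poly p (u n))"
        using u.eventually_poly_nonzero[OF nz(3)]
        by eventually_elim (use c'(1) le ball in \<open>auto intro: less_le_trans\<close>)
      then show ?thesis unfolding \<phi> Wu u.Fract_in_V_dom[OF q] .
    qed
    then show ?thesis using W1 W2 nz b d
      by (intro exI[of _ "{level_set f c, level_set b d}"]) auto
  qed
qed

text \<open>An intersection is handled by the union of the two finite families, a union of open sets
  by the family for one member containing \<open>W\<close>.\<close>

lemma level_sets_refine_open:
  assumes "openin (zariski_topology (V_space v)) U" "W \<in> U"
  shows "\<exists>J\<subseteq>{level_set f c | f c. f \<noteq> 0 \<and> c \<noteq> 0}. finite J \<and>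
    (\<forall>W'\<in>V_space v. (\<forall>B\<in>J. W' \<in> B \<longleftrightarrow> W \<in> B) \<longrightarrow> W' \<in> U)"
  using assms unfolding zariski_topology_def openin_topology_generated_by_iff
proof (induction rule: generate_topology_on.induct)
  case (Int U1 U2)
  from Int.prems have "W \<in> U1" "W \<in> U2" by auto
  from Int.IH(1)[OF this(1)] Int.IH(2)[OF this(2)] obtain J1 J2 where
    "J1 \<subseteq> {level_set f c | f c. f \<noteq> 0 \<and> c \<noteq> 0}" "finite J1"
    "\<forall>W'\<in>V_space v. (\<forall>B\<in>J1. W' \<in> B \<longleftrightarrow> W \<in> B) \<longrightarrow> W' \<in> U1"
    "J2 \<subseteq> {level_set f c | f c. f \<noteq> 0 \<and> c \<noteq> 0}" "finite J2"
    "\<forall>W'\<in>V_space v. (\<forall>B\<in>J2. W' \<in> B \<longleftrightarrow> W \<in> B) \<longrightarrow> W' \<in> U2"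
    by auto
  then show ?case by (intro exI[of _ "J1 \<union> J2"]) auto
next
  case (UN K)
  then obtain U where U: "U \<in> K" "W \<in> U" by blast
  from UN.IH[OF this] obtain J where
    "J \<subseteq> {level_set f c | f c. f \<noteq> 0 \<and> c \<noteq> 0}" "finite J"
    "\<forall>W'\<in>V_space v. (\<forall>B\<in>J. W' \<in> B \<longleftrightarrow> W \<in> B) \<longrightarrow> W' \<in> U"
    by auto
  then show ?case using U(1) by (intro exI[of _ J]) auto
next
  case (Basis U)
  then obtain \<phi> where "U = {W \<in> V_space v. \<phi> \<in> W}" by blast
  then show ?case using Basis.prems level_sets_refine_basis[of W \<phi>] by simp
qed simp

lemma t0_space_zariski: "t0_space (zariski_topology (V_space v))"
  unfolding t0_space_def topspace_zariski
proof (intro ballI impI)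
  fix W W' assume W: "W \<in> V_space v" "W' \<in> V_space v" "W \<noteq> W'"
  then obtain \<phi> where "\<phi> \<in> W \<longleftrightarrow> \<phi> \<notin> W'" by blast
  then show "\<exists>U. openin (zariski_topology (V_space v)) U \<and> (W \<notin> U \<longleftrightarrow> W' \<in> U)"
    using W openin_zariski_basis[of \<phi>] by (intro exI[of _ "{W \<in> V_space v. \<phi> \<in> W}"]) auto
qed

lemma metrizable_space_zariski:
  assumes "countable (UNIV :: 'a set)"
  shows "metrizable_space (zariski_topology (V_space v))"
proof (rule metrizable_space_countable_clopen_base)
  have "{level_set f c | f c. f \<noteq> 0 \<and> c \<noteq> 0} \<subseteq> case_prod level_set ` (UNIV \<times> UNIV)"
    by auto
  then show "countable {level_set f c | f c. f \<noteq> 0 \<and> c \<noteq> 0}"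
    by (rule countable_subset) (use assms countable_poly[OF assms] in blast)
  show "\<exists>J\<subseteq>{level_set f c | f c. f \<noteq> 0 \<and> c \<noteq> 0}. finite J \<and>
      (\<forall>W'\<in>topspace (zariski_topology (V_space v)). (\<forall>B\<in>J. W' \<in> B \<longleftrightarrow> W \<in> B) \<longrightarrow> W' \<in> U)"
    if "openin (zariski_topology (V_space v)) U" "W \<in> U" for U W
    unfolding topspace_zariski by (rule level_sets_refine_open[OF that])
qed (use t0_space_zariski openin_level_set closedin_level_set in auto)

end

theorem corollary6p16:
  fixes V :: "'a::field set" and v :: "'a \<Rightarrow> ereal"
  assumes "valuation_domain V"
    and "valuation_rank V = 1"
    and "countable V"
    and "real_valuation v"
    and "V = valuation_ring v"
    and "Ostrowski_domains v \<noteq> {}"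
  shows "metrizable_space (zariski_topology (V_space v))"
proof -
  interpret real_valued_field v using assms(4) by unfold_locales
  show ?thesis
    by (rule metrizable_space_zariski[OF valuation_domain_countable_field[OF assms(1,3)]])
qed

end
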